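(* Let $n>1$ and $m\ge 1$ be integers, let $A\in\mathbb{R}^{n\times m}$ and $B\in\mathbb{R}^{m\times n}$, and fix $k\in\{1,\dots,n\}$. Let $w^i\in\mathbb{R}^n$, $i=1,\dots,m$, denote the $i$th column of $A$, and let $(v^j)^T$, with $v^j\in\mathbb{R}^n$, $j=1,\dots,m$, denote the $j$th row of $B$. Then $$(AB)^{[k]} = L_{n,k}\sum_{i=1}^m\sum_{\ell=1}^k(-1)^{\ell+1}H_{n,k,\ell}((w^i)^T)\,H_{n,k,1}(v^i)\,M_{n,k}.$$
   Context: For integers $n\ge 1$ and $k\in\{1,\dots,n\}$, $Q(n,k)$ denotes the list of all strictly increasing sequences $(i_1,\dots,i_k)$ of $k$ integers in $\{1,\dots,n\}$, ordered lexicographically. For $A\in\mathbb{R}^{n\times m}$ and $k\in\{1,\dots,\min\{n,m\}\}$, the $k$-multiplicative compound $A^{(k)}$ is the $\binom{n}{k}\times\binom{m}{k}$ matrix of all $k\times k$ minors of $A$ in lexicographic order: its entry in the row indexed by $\alpha\in Q(n,k)$ and the column indexed by $\beta\in Q(m,k)$ is the minor of $A$ with rows $\alpha$ and columns $\beta$. In particular, for $x^1,\dots,x^k\in\mathbb{R}^n$, $\begin{bmatrix}x^1&\dots&x^k\end{bmatrix}^{(k)}$ is a column vector in $\mathbb{R}^{\binom{n}{k}}$. For $C\in\mathbb{R}^{n\times n}$, the $k$-additive compound $C^{[k]}$ is the $\binom{n}{k}\times\binom{n}{k}$ matrix that is the coefficient of $\varepsilon^1$ in the expansion of $(I_n+\varepsilon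 C)^{(k)}$ as a polynomial in $\varepsilon$. $\otimes$ is the Kronecker product. Let $e^1,\dots,e^n$ be the canonical basis of $\mathbb{R}^n$. The matrices $M_{n,k}\in\mathbb{R}^{n^k\times\binom{n}{k}}$ and $L_{n,k}\in\mathbb{R}^{\binom{n}{k}\times n^k}$ are $$M_{n,k}:=\sum_{(i_1,\dots,i_k)\in Q(n,k)}\ \sum_{(j_1,\dots,j_k)\in S(i_1,\dots,i_k)}\sigma(j_1,\dots,j_k)\,(e^{j_1}\otimes\dots\otimes e^{j_k})\left(\begin{bmatrix}e^{i_1}&\dots&e^{i_k}\end{bmatrix}^{(k)}\right)^T,$$ $$L_{n,k}:=\sum_{(i_1,\dots,i_k)\in Q(n,k)}\begin{bmatrix}e^{i_1}&\dots&e^{i_k}\end{bmatrix}^{(k)}(e^{i_1}\otimes\dots\otimes e^{i_k})^T,$$ where $S(i_1,\dots,i_k)$ is the set of all permutations (rearrangements) of the sequence $(i_1,\dots,i_k)$ and $\sigma(j_1,\dots,j_k)\in\{-1,1\}$ is the signature of the permutation $(j_1,\dots,j_k)$ relative to increasing order. For $n>1$, $k\in\{1,\dots,n\}$, $i\in\{1,\dots,k\}$ and a vector $v\in\mathbb{R}^n$, $$H_{n,k,i}(v):=I_n\otimes\dots\otimes I_n\otimes v^T\otimes I_n\otimes\dots\otimes I_n\in\mathbb{R}^{n^{k-1}\times n^k},$$ where the product has $k$ factors, with $v^T$ in the $i$th place and $I_n$ in all other places. The same formula is used with a row vector as argument: for $w\in\mathbb{R}^n$, $H_{n,k,i}(w^T):=I_n\otimes\dots\otimes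 I_n\otimes w\otimes I_n\otimes\dots\otimes I_n\in\mathbb{R}^{n^k\times n^{k-1}}$, with the column vector $w$ in the $i$th place. *)

theory Defs
  imports
    "Jordan_Normal_Form.Determinant"
    "HOL-Computational_Algebra.Polynomial"
    "HOL-Combinatorics.Multiset_Permutations"
    "HOL-Library.List_Lexorder"
begin

text \<open>
  Matrix indices and the entries of index sequences are counted from 0, as usual for the type
  \<open>mat\<close>; the position \<open>i\<close> in \<open>H_mat n k i\<close> is counted from 1.
\<close>

text \<open>The order on \<open>nat list\<close> used by \<open>sorted_list_of_set\<close> is the lexicographic one.\<close>

definition Q_seq :: "nat \<Rightarrow> nat \<Rightarrow> nat list list" where
  "Q_seq n k = sorted_list_of_set
     {\<alpha>. length \<alpha> = k \<and> sorted_wrt (<) \<alpha> \<and> set \<alpha> \<subseteq> {0..<n}}"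

definition minor :: "'a :: comm_ring_1 mat \<Rightarrow> nat list \<Rightarrow> nat list \<Rightarrow> 'a" where
  "minor A \<alpha> \<beta> = det (mat (length \<alpha>) (length \<beta>) (\<lambda>(i, j). A $$ (\<alpha> ! i, \<beta> ! j)))"

definition mult_compound :: "nat \<Rightarrow> 'a :: comm_ring_1 mat \<Rightarrow> 'a mat" where
  "mult_compound k A =
     mat (dim_row A choose k) (dim_col A choose k)
       (\<lambda>(r, c). minor A (Q_seq (dim_row A) k ! r) (Q_seq (dim_col A) k ! c))"

text \<open>The indeterminate \<open>\<epsilon>\<close> is the polynomial \<open>[:0, 1:]\<close>.\<close>

definition add_compound :: "nat \<Rightarrow> real mat \<Rightarrow> real mat" where
  "add_compound k C =
     map_mat (\<lambda>p. coeff p 1)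
       (mult_compound k (1\<^sub>m (dim_row C) + [:0, 1:] \<cdot>\<^sub>m map_mat (\<lambda>c. [:c:]) C))"

definition kron :: "'a :: comm_ring_1 mat \<Rightarrow> 'a mat \<Rightarrow> 'a mat" where
  "kron A B = mat (dim_row A * dim_row B) (dim_col A * dim_col B)
     (\<lambda>(i, j). A $$ (i div dim_row B, j div dim_col B) * B $$ (i mod dim_row B, j mod dim_col B))"

definition kron_list :: "'a :: comm_ring_1 mat list \<Rightarrow> 'a mat" where
  "kron_list As = foldr kron As (1\<^sub>m 1)"

definition col_vector :: "'a vec \<Rightarrow> 'a mat" where
  "col_vector v = mat_of_cols (dim_vec v) [v]"

text \<open>Sums of \<open>nr \<times> nc\<close> matrices; all summands must have these dimensions.\<close>

abbreviation mat_sum :: "nat \<Rightarrow> nat \<Rightarrow> ('i \<Rightarrow> real mat) \<Rightarrow> 'i set \<Rightarrow> real mat" where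
  "mat_sum nr nc \<equiv> finsum (module_mat TYPE(real) nr nc)"

text \<open>For distinct entries, the permutation that carries the increasing arrangement to \<open>\<beta>\<close>
  is unique.\<close>

definition signature :: "nat list \<Rightarrow> int" where
  "signature \<beta> =
     sign (THE p. p permutes {..<length \<beta>} \<and> permute_list p (sort \<beta>) = \<beta>)"

definition basis_kron :: "nat \<Rightarrow> nat list \<Rightarrow> real mat" where
  "basis_kron n \<alpha> = kron_list (map (\<lambda>i. col_vector (unit_vec n i)) \<alpha>)"

definition basis_compound :: "nat \<Rightarrow> nat list \<Rightarrow> real mat" where
  "basis_compound n \<alpha> = mult_compound (length \<alpha>) (mat_of_cols n (map (unit_vec n) \<alpha>))"

definition M_mat :: "nat \<Rightarrow> nat \<Rightarrow> real mat" where
  "M_mat n k =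
     mat_sum (n ^ k) (n choose k)
       (\<lambda>\<alpha>. mat_sum (n ^ k) (n choose k)
          (\<lambda>\<beta>. of_int (signature \<beta>) \<cdot>\<^sub>m (basis_kron n \<beta> * (basis_compound n \<alpha>)\<^sup>T))
          (permutations_of_multiset (mset \<alpha>)))
       (set (Q_seq n k))"

definition L_mat :: "nat \<Rightarrow> nat \<Rightarrow> real mat" where
  "L_mat n k =
     mat_sum (n choose k) (n ^ k)
       (\<lambda>\<alpha>. basis_compound n \<alpha> * (basis_kron n \<alpha>)\<^sup>T)
       (set (Q_seq n k))"

text \<open>The argument is a matrix, so that both column vectors and row vectors can be inserted.\<close>

definition H_mat :: "nat \<Rightarrow> nat \<Rightarrow> nat \<Rightarrow> real mat \<Rightarrow> real mat" where
  "H_mat n k i V = kron_list (replicate (i - 1) (1\<^sub>m n) @ [V\<^sup>T] @ replicate (k - i) (1\<^sub>m n))"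

lemma finite_Q_set: "finite {\<alpha>. length \<alpha> = k \<and> sorted_wrt (<) \<alpha> \<and> set \<alpha> \<subseteq> {0..<n::nat}}"
  by (rule finite_subset[OF _ finite_lists_length_eq[of "{0..<n}" k]]) auto

lemma set_Q_seq: "set (Q_seq n k) = {\<alpha>. length \<alpha> = k \<and> sorted_wrt (<) \<alpha> \<and> set \<alpha> \<subseteq> {0..<n}}"
  unfolding Q_seq_def by (rule set_sorted_list_of_set[OF finite_Q_set])

lemma length_Q_seq: "length (Q_seq n k) = n choose k"
proof -
  let ?S = "{\<alpha>. length \<alpha> = k \<and> sorted_wrt (<) \<alpha> \<and> set \<alpha> \<subseteq> {0..<n}}"
  have "bij_betw set ?S {X. X \<subseteq> {0..<n} \<and> card X = k}"
  proof (rule bij_betw_byWitness[where f' = sorted_list_of_set])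
    show "\<forall>\<alpha>\<in>?S. sorted_list_of_set (set \<alpha>) = \<alpha>"
      by (auto simp: strict_sorted_iff sorted_list_of_set.idem_if_sorted_distinct)
    show "\<forall>X\<in>{X. X \<subseteq> {0..<n} \<and> card X = k}. set (sorted_list_of_set X) = X"
      by (auto dest: finite_subset[OF _ finite_atLeastLessThan])
    show "set ` ?S \<subseteq> {X. X \<subseteq> {0..<n} \<and> card X = k}"
      by (auto simp: strict_sorted_iff distinct_card)
    show "sorted_list_of_set ` {X. X \<subseteq> {0..<n} \<and> card X = k} \<subseteq> ?S"
      using finite_subset[OF _ finite_atLeastLessThan, of _ 0 n] by fastforce
  qed
  then have "card ?S = card {X. X \<subseteq> {0..<n} \<and> card X = k}" by (rule bij_betw_same_card)
  then show ?thesis by (simp add: Q_seq_def n_subsets)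
qed

lemma signature_perm_unique:
  fixes \<beta> :: "nat list"
  assumes "distinct \<beta>"
  shows "\<exists>!p. p permutes {..<length \<beta>} \<and> permute_list p (sort \<beta>) = \<beta>"
proof -
  obtain p where p: "p permutes {..<length \<beta>}" "permute_list p (sort \<beta>) = \<beta>"
    using mset_eq_permutation[of "\<beta>" "sort \<beta>"] by auto
  have "q = p" if q: "q permutes {..<length \<beta>}" "permute_list q (sort \<beta>) = \<beta>" for q
  proof
    fix i
    show "q i = p i"
    proof (cases "i < length \<beta>")
      case True
      have "sort \<beta> ! q i = sort \<beta> ! p i"
        using p q True permute_list_nth[of q "sort \<beta>" i] permute_list_nth[of p "sort \<beta>" i] by simp
      moreover have "q i < length \<beta>" "p i < length \<beta>"
        using p(1) q(1) True permutes_in_image by fastforce+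
      ultimately show ?thesis using assms by (simp add: nth_eq_iff_index_eq)
    next
      case False
      then show ?thesis using p(1) q(1) by (simp add: permutes_not_in)
    qed
  qed
  then show ?thesis using p by blast
qed

lemma mult_compound_carrier:
  "A \<in> carrier_mat n m \<Longrightarrow> mult_compound k A \<in> carrier_mat (n choose k) (m choose k)"
  by (simp add: mult_compound_def)

lemma kron_list_carrier:
  "kron_list As \<in> carrier_mat (prod_list (map dim_row As)) (prod_list (map dim_col As))"
  by (induction As) (auto simp: kron_list_def kron_def)

lemma basis_kron_carrier: "basis_kron n \<alpha> \<in> carrier_mat (n ^ length \<alpha>) 1"
  using kron_list_carrier[of "map (\<lambda>i. col_vector (unit_vec n i)) \<alpha>"]
  by (simp add: basis_kron_def col_vector_def o_def map_replicate_const)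

lemma basis_compound_carrier: "basis_compound n \<alpha> \<in> carrier_mat (n choose length \<alpha>) 1"
  by (simp add: basis_compound_def mult_compound_def)

lemma mat_sum_carrier:
  assumes "\<And>i. i \<in> S \<Longrightarrow> f i \<in> carrier_mat nr nc"
  shows "mat_sum nr nc f S \<in> carrier_mat nr nc"
proof -
  interpret abelian_group "module_mat TYPE(real) nr nc" by (rule abelian_group_mat)
  show ?thesis using finsum_closed[of f S] assms by (auto simp: module_mat_simps)
qed

lemma M_mat_carrier: "M_mat n k \<in> carrier_mat (n ^ k) (n choose k)"
proof -
  have "of_int (signature \<beta>) \<cdot>\<^sub>m (basis_kron n \<beta> * (basis_compound n \<alpha>)\<^sup>T)
      \<in> carrier_mat (n ^ k) (n choose k)"
    if "\<alpha> \<in> set (Q_seq n k)" "\<beta> \<in> permutations_of_multiset (mset \<alpha>)" for \<alpha> \<beta>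
  proof -
    have "length \<alpha> = k" using that(1) by (simp add: set_Q_seq)
    moreover have "length \<beta> = length \<alpha>"
      using that(2) by (metis permutations_of_multisetD size_mset)
    ultimately show ?thesis
      using basis_kron_carrier[of n \<beta>] basis_compound_carrier[of n \<alpha>] by auto
  qed
  then show ?thesis
    unfolding M_mat_def
    by (auto intro!: mat_sum_carrier)
qed

lemma L_mat_carrier: "L_mat n k \<in> carrier_mat (n choose k) (n ^ k)"
proof -
  have "basis_compound n \<alpha> * (basis_kron n \<alpha>)\<^sup>T \<in> carrier_mat (n choose k) (n ^ k)"
    if "\<alpha> \<in> set (Q_seq n k)" for \<alpha>
    using that basis_kron_carrier[of n \<alpha>] basis_compound_carrier[of n \<alpha>] by (auto simp: set_Q_seq)
  then show ?thesis
    unfolding L_mat_def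
    by (auto intro!: mat_sum_carrier)
qed

lemma H_mat_col_carrier:
  assumes "v \<in> carrier_vec n" "i \<in> {1..k}"
  shows "H_mat n k i (col_vector v) \<in> carrier_mat (n ^ (k - 1)) (n ^ k)"
proof -
  have "n ^ (i - 1) * n ^ (k - i) = n ^ (k - 1)" "n ^ (i - 1) * (n * n ^ (k - i)) = n ^ k"
    using assms(2) by (simp_all flip: power_add power_Suc)
  with kron_list_carrier[of "replicate (i - 1) (1\<^sub>m n) @ [(col_vector v)\<^sup>T] @ replicate (k - i) (1\<^sub>m n)"] assms(1)
  show ?thesis by (simp add: H_mat_def col_vector_def)
qed

lemma H_mat_row_carrier:
  assumes "w \<in> carrier_vec n" "i \<in> {1..k}"
  shows "H_mat n k i ((col_vector w)\<^sup>T) \<in> carrier_mat (n ^ k) (n ^ (k - 1))"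
proof -
  have "n ^ (i - 1) * n ^ (k - i) = n ^ (k - 1)" "n ^ (i - 1) * (n * n ^ (k - i)) = n ^ k"
    using assms(2) by (simp_all flip: power_add power_Suc)
  with kron_list_carrier[of "replicate (i - 1) (1\<^sub>m n) @ [((col_vector w)\<^sup>T)\<^sup>T] @ replicate (k - i) (1\<^sub>m n)"] assms(1)
  show ?thesis by (simp add: H_mat_def col_vector_def)
qed

end

theory Submission
  imports Defs
begin

text \<open>
  The matrix \<open>M_mat\<close> embeds the compound space into the \<open>k\<close>-fold tensors as antisymmetrised basis
  tensors, and \<open>L_mat\<close> reads off the coordinates at increasing index sequences. Contracting the
  first tensor slot with \<open>v\<close> and inserting \<open>w\<close> as a new factor in slot \<open>l\<close> replaces one index of an
  antisymmetrised tensor: it moves the replaced factor from the front to slot \<open>l\<close>, which costs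
  the sign of a cycle of length \<open>l\<close>. The factor \<open>(-1) ^ (l + 1)\<close> cancels this sign, so that the sum
  over \<open>l\<close> lets the rank-one matrix \<open>w v\<^sup>T\<close> act on one factor at a time, as the additive compound
  of \<open>w v\<^sup>T\<close> does. Since \<open>A * B\<close> is the sum of the rank-one matrices formed from the columns
  of \<open>A\<close> and the rows of \<open>B\<close>, summing over them gives the additive compound of \<open>A * B\<close>.

  The proof compares the entries for two increasing sequences \<open>\<alpha>\<close> (row) and \<open>\<beta>\<close> (column), with
  \<open>C = A * B\<close>. Both turn out to be the sum over the positions \<open>l\<close>, counted from 0, and over the
  rearrangements \<open>\<xi>\<close> of \<open>\<beta>\<close> whose tail is \<open>\<alpha>\<close> without its entry at \<open>l\<close>, of the terms
  \<open>(-1) ^ l * signature \<xi> * C $$ (\<alpha> ! l, hd \<xi>)\<close>.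

  For the additive compound this is \<open>index_add_compound\<close>: the linear coefficient of a minor of
  the identity plus the indeterminate times \<open>C\<close> is a sum over \<open>l\<close> and over permutations
  (\<open>coeff_1_minor\<close>), and composing each permutation with a cycle moves the position \<open>l\<close> to the front
  (\<open>sum_minor_terms_eq_rearrangements\<close>). For the other side, \<open>index_L_mult_M\<close> reduces the entry to
  matrix elements between basis tensors, which \<open>matrix_element_of_insertion_and_contraction\<close>
  evaluates by means of the mixed-product rule for Kronecker products.
\<close>

section \<open>Kronecker products of lists of matrices\<close>

lemma sum_div_mod:
  fixes g :: "nat \<Rightarrow> nat \<Rightarrow> 'a :: comm_monoid_add"
  shows "(\<Sum>p<b * d. g (p div d) (p mod d)) = (\<Sum>x<b. \<Sum>y<d. g x y)"
proof -
  have "(\<Sum>p<b * d. g (p div d) (p mod d)) =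
      (\<Sum>x<b. \<Sum>p = x * d..<x * d + d. g (p div d) (p mod d))"
    by (rule sum.nat_group[symmetric])
  also have "\<dots> = (\<Sum>x<b. \<Sum>y<d. g x y)"
  proof (rule sum.cong[OF refl])
    fix x
    have "(\<Sum>p = x * d..<x * d + d. g (p div d) (p mod d)) =
        (\<Sum>y = 0..<d. g ((y + x * d) div d) ((y + x * d) mod d))"
      using sum.shift_bounds_nat_ivl[of "\<lambda>p. g (p div d) (p mod d)" 0 "x * d" d]
      by (simp add: add.commute)
    also have "\<dots> = (\<Sum>y<d. g x y)"
      by (rule sum.cong) auto
    finally show "(\<Sum>p = x * d..<x * d + d. g (p div d) (p mod d)) = (\<Sum>y<d. g x y)" .
  qed
  finally show ?thesis .
qed

text \<open>
  The mixed-product rule. It lets every product of Kronecker products below be evaluated factor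
  by factor, so that no bookkeeping of mixed-radix row and column indices is needed later.
\<close>

lemma kron_mult:
  assumes "dim_col A = dim_row A'" and "dim_col B = dim_row B'"
  shows "kron A B * kron A' B' = kron (A * A') (B * B')"
proof (rule eq_matI)
  fix i j
  assume "i < dim_row (kron (A * A') (B * B'))" "j < dim_col (kron (A * A') (B * B'))"
  then have ij: "i < dim_row A * dim_row B" "j < dim_col A' * dim_col B'"
    by (simp_all add: kron_def)
  then have pos: "0 < dim_row B" "0 < dim_col B'"
    by (auto intro: gr0I)
  have bounds: "i div dim_row B < dim_row A" "j div dim_col B' < dim_col A'"
    "i mod dim_row B < dim_row B" "j mod dim_col B' < dim_col B'"
    using ij pos by (simp_all add: less_mult_imp_div_less)
  let ?r = "i div dim_row B" and ?r' = "i mod dim_row B"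
  let ?c = "j div dim_col B'" and ?c' = "j mod dim_col B'"
  define g where "g = (\<lambda>x y. (A $$ (?r, x) * B $$ (?r', y)) * (A' $$ (x, ?c) * B' $$ (y, ?c')))"
  have "(kron A B * kron A' B') $$ (i, j) =
      (\<Sum>p<dim_row A' * dim_row B'. g (p div dim_row B') (p mod dim_row B'))"
    using ij assms by (simp add: kron_def scalar_prod_def g_def atLeast0LessThan)
  also have "\<dots> = (\<Sum>x<dim_row A'. \<Sum>y<dim_row B'. g x y)"
    by (rule sum_div_mod)
  also have "\<dots> = (\<Sum>x<dim_row A'. A $$ (?r, x) * A' $$ (x, ?c)) *
      (\<Sum>y<dim_row B'. B $$ (?r', y) * B' $$ (y, ?c'))"
    by (simp add: g_def sum_product ac_simps)
  also have "\<dots> = kron (A * A') (B * B') $$ (i, j)"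
    using ij bounds assms by (simp add: kron_def scalar_prod_def atLeast0LessThan)
  finally show "(kron A B * kron A' B') $$ (i, j) = kron (A * A') (B * B') $$ (i, j)" .
qed (simp_all add: kron_def)

lemma kron_scalar_left:
  assumes "U \<in> carrier_mat 1 1"
  shows "kron U A = U $$ (0, 0) \<cdot>\<^sub>m A"
  using assms by (intro eq_matI) (auto simp: kron_def)

lemma kron_list_Nil: "kron_list [] = 1\<^sub>m 1"
  by (simp add: kron_list_def)

lemma kron_list_Cons: "kron_list (A # As) = kron A (kron_list As)"
  by (simp add: kron_list_def)

lemma dim_kron_list:
  "dim_row (kron_list As) = prod_list (map dim_row As)"
  "dim_col (kron_list As) = prod_list (map dim_col As)"
  using kron_list_carrier[of As] by auto

lemma kron_list_mult:
  assumes "list_all2 (\<lambda>A B. dim_col A = dim_row B) As Bs"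
  shows "kron_list As * kron_list Bs = kron_list (map2 (*) As Bs)"
  using assms
proof (induction rule: list_all2_induct)
  case Nil
  show ?case by (simp add: kron_list_Nil)
next
  case (Cons A As B Bs)
  have "map dim_col As = map dim_row Bs"
    using Cons.hyps(2) by (auto simp: list_all2_conv_all_nth intro!: nth_equalityI)
  then have "dim_col (kron_list As) = dim_row (kron_list Bs)"
    by (simp add: dim_kron_list)
  with Cons show ?case
    by (simp add: kron_list_Cons kron_mult)
qed

text \<open>
  A factor of size \<open>1 \<times> 1\<close> can be added at any place. This reconciles the numbers of factors
  when the \<open>k\<close> factors of an insertion \<open>H_mat n k l ((col_vector w)\<^sup>T)\<close> are applied to a product of \<open>k - 1\<close>
  basis vectors: the inserted column \<open>w\<close> multiplies an identity matrix of size 1.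
\<close>

lemma kron_list_insert_one: "kron_list (As @ 1\<^sub>m 1 # Bs) = kron_list (As @ Bs)"
proof (induction As)
  case Nil
  have "1 \<cdot>\<^sub>m kron_list Bs = kron_list Bs"
    by (rule eq_matI) auto
  then show ?case
    by (simp add: kron_list_Cons kron_scalar_left)
qed (simp add: kron_list_Cons)

lemma transpose_kron: "(kron A B)\<^sup>T = kron A\<^sup>T B\<^sup>T"
proof (rule eq_matI)
  fix i j
  assume "i < dim_row (kron A\<^sup>T B\<^sup>T)" "j < dim_col (kron A\<^sup>T B\<^sup>T)"
  then have ij: "i < dim_col A * dim_col B" "j < dim_row A * dim_row B"
    by (simp_all add: kron_def)
  then have "0 < dim_col B" "0 < dim_row B"
    by (auto intro: gr0I)
  with ij show "(kron A B)\<^sup>T $$ (i, j) = kron A\<^sup>T B\<^sup>T $$ (i, j)"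
    by (simp add: kron_def less_mult_imp_div_less)
qed (simp_all add: kron_def)

lemma transpose_kron_list: "(kron_list As)\<^sup>T = kron_list (map transpose_mat As)"
  by (induction As) (simp_all add: kron_list_Nil kron_list_Cons transpose_kron)

text \<open>
  For \<open>1 \<times> 1\<close> factors, such as the pairings of the factors of two decomposable tensors, the
  corner is the only entry. An empty factor would have no corner, hence the hypothesis.
\<close>

lemma kron_list_corner:
  assumes "\<And>A. A \<in> set As \<Longrightarrow> 0 < dim_row A \<and> 0 < dim_col A"
  shows "kron_list As $$ (0, 0) = (\<Prod>A\<leftarrow>As. A $$ (0, 0))"
  using assms
proof (induction As)
  case (Cons A As)
  then have "0 < dim_row (kron_list As)" "0 < dim_col (kron_list As)"
    by (auto simp: dim_kron_list intro!: gr0I) (metis neq0_conv)+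
  with Cons show ?case
    by (simp add: kron_list_Cons kron_def)
qed (simp add: kron_list_Nil)

section \<open>Contracting and inserting tensor factors\<close>

abbreviation basis_col :: "nat \<Rightarrow> nat \<Rightarrow> real mat" where
  "basis_col n i \<equiv> col_vector (unit_vec n i)"

lemma dim_col_vector [simp]: "dim_row (col_vector v) = dim_vec v" "dim_col (col_vector v) = 1"
  by (simp_all add: col_vector_def)

lemma transpose_col_vector_mult:
  assumes "dim_vec v = dim_vec w"
  shows "(col_vector v)\<^sup>T * col_vector w = mat 1 1 (\<lambda>_. v \<bullet> w)"
  using assms by (intro eq_matI) (auto simp: col_vector_def mat_of_cols_def scalar_prod_def)

text \<open>
  For a column vector as argument, the transposition in \<open>H_mat\<close> makes its first factor the row
  \<open>v\<^sup>T\<close>, so that \<open>H_mat\<close> is the contraction of a tensor with \<open>v\<close> in the first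
  slot. The resulting \<open>1 \<times> 1\<close> factor is the scalar \<open>v $ b\<close>.
\<close>

lemma contract_first_factor:
  assumes "v \<in> carrier_vec n" and "b < n" and "k = Suc (length \<gamma>)"
  shows "H_mat n k 1 (col_vector v) * basis_kron n (b # \<gamma>) = v $ b \<cdot>\<^sub>m basis_kron n \<gamma>"
proof -
  have id: "map2 (*) (replicate (length \<gamma>) (1\<^sub>m n)) (map (basis_col n) \<gamma>) = map (basis_col n) \<gamma>"
    by (auto intro!: nth_equalityI left_mult_one_mat')
  have "H_mat n k 1 (col_vector v) * basis_kron n (b # \<gamma>) =
      kron_list (map2 (*) ((col_vector v)\<^sup>T # replicate (length \<gamma>) (1\<^sub>m n)) (map (basis_col n) (b # \<gamma>)))"
    unfolding H_mat_def basis_kron_def using assms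
    by (subst kron_list_mult) (auto simp: list_all2_conv_all_nth nth_Cons split: nat.split)
  also have "\<dots> = kron (mat 1 1 (\<lambda>_. v \<bullet> unit_vec n b)) (kron_list (map (basis_col n) \<gamma>))"
    using assms by (simp add: kron_list_Cons id transpose_col_vector_mult)
  also have "\<dots> = v $ b \<cdot>\<^sub>m basis_kron n \<gamma>"
    using assms by (simp add: kron_scalar_left basis_kron_def)
  finally show ?thesis .
qed

text \<open>
  For a row vector as argument, the transposition in \<open>H_mat\<close> makes its \<open>l\<close>-th factor the column
  \<open>w\<close>, so that \<open>H_mat\<close> inserts \<open>w\<close> as a new factor. The tensor is written as
  \<open>\<gamma> @ \<delta>\<close> to mark the place between its factors where \<open>w\<close> goes.
\<close>

lemma insert_factor:
  assumes "w \<in> carrier_vec n"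
    and "k = Suc (length \<gamma> + length \<delta>)" and "l = Suc (length \<gamma>)"
  shows "H_mat n k l ((col_vector w)\<^sup>T) * basis_kron n (\<gamma> @ \<delta>) =
    kron_list (map (basis_col n) \<gamma> @ col_vector w # map (basis_col n) \<delta>)"
proof -
  have id: "map2 (*) (replicate (length \<xi>) (1\<^sub>m n)) (map (basis_col n) \<xi>) = map (basis_col n) \<xi>" for \<xi>
    by (auto intro!: nth_equalityI left_mult_one_mat')
  have "H_mat n k l ((col_vector w)\<^sup>T) * basis_kron n (\<gamma> @ \<delta>) =
      kron_list (replicate (length \<gamma>) (1\<^sub>m n) @ col_vector w # replicate (length \<delta>) (1\<^sub>m n)) *
      kron_list (map (basis_col n) \<gamma> @ 1\<^sub>m 1 # map (basis_col n) \<delta>)"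
    using assms by (simp add: H_mat_def basis_kron_def kron_list_insert_one del: One_nat_def)
  also have "\<dots> = kron_list (map2 (*)
      (replicate (length \<gamma>) (1\<^sub>m n) @ col_vector w # replicate (length \<delta>) (1\<^sub>m n))
      (map (basis_col n) \<gamma> @ 1\<^sub>m 1 # map (basis_col n) \<delta>))"
    by (rule kron_list_mult)
      (auto simp: list_all2_conv_all_nth nth_append nth_Cons split: nat.split)
  also have "\<dots> = kron_list (map (basis_col n) \<gamma> @ col_vector w # map (basis_col n) \<delta>)"
    by (simp add: id right_mult_one_mat')
  finally show ?thesis .
qed

lemma coordinate_of_inserted:
  assumes "w \<in> carrier_vec n" and "a < n" and "set \<alpha> \<union> set \<alpha>' \<union> set \<gamma> \<union> set \<delta> \<subseteq> {..<n}"
    and "length \<alpha> = length \<gamma>" and "length \<alpha>' = length \<delta>"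
  shows "((basis_kron n (\<alpha> @ a # \<alpha>'))\<^sup>T *
      kron_list (map (basis_col n) \<gamma> @ col_vector w # map (basis_col n) \<delta>)) $$ (0, 0) =
    (if \<alpha> = \<gamma> \<and> \<alpha>' = \<delta> then w $ a else 0)"
proof -
  let ?row = "\<lambda>i. (basis_col n i)\<^sup>T"
  have delta: "(\<Prod>A\<leftarrow>map2 (*) (map ?row \<xi>) (map (basis_col n) \<eta>). A $$ (0, 0)) =
      (if \<xi> = \<eta> then 1 else 0)"
    if "length \<xi> = length \<eta>" "set \<xi> \<subseteq> {..<n}" "set \<eta> \<subseteq> {..<n}" for \<xi> \<eta>
    using that
    by (induction rule: list_induct2) (auto simp: transpose_col_vector_mult)
  have "(basis_kron n (\<alpha> @ a # \<alpha>'))\<^sup>T *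
      kron_list (map (basis_col n) \<gamma> @ col_vector w # map (basis_col n) \<delta>) =
    kron_list (map2 (*) (map ?row \<alpha> @ ?row a # map ?row \<alpha>')
      (map (basis_col n) \<gamma> @ col_vector w # map (basis_col n) \<delta>))"
    unfolding basis_kron_def transpose_kron_list using assms
    by (subst kron_list_mult)
      (auto simp: list_all2_conv_all_nth nth_append nth_Cons o_def split: nat.split)
  also have "\<dots> $$ (0, 0) = (\<Prod>A\<leftarrow>map2 (*) (map ?row \<alpha> @ ?row a # map ?row \<alpha>')
      (map (basis_col n) \<gamma> @ col_vector w # map (basis_col n) \<delta>). A $$ (0, 0))"
    using assms by (intro kron_list_corner) (auto simp: set_zip nth_append nth_Cons split: nat.splits)
  also have "\<dots> = (if \<alpha> = \<gamma> \<and> \<alpha>' = \<delta> then w $ a else 0)"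
    using assms delta[of \<alpha> \<gamma>] delta[of \<alpha>' \<delta>]
    by (simp add: transpose_col_vector_mult)
  finally show ?thesis .
qed

section \<open>Entries of the change-of-basis matrices\<close>

text \<open>
  The sums in the module of matrices are reduced to sums of real numbers here, so that the usual
  rules for exchanging sums apply.
\<close>

lemma index_mat_sum:
  assumes "finite S" and "\<And>x. x \<in> S \<Longrightarrow> f x \<in> carrier_mat nr nc" and "i < nr" "j < nc"
  shows "mat_sum nr nc f S $$ (i, j) = (\<Sum>x\<in>S. f x $$ (i, j))"
proof -
  interpret abelian_group "module_mat TYPE(real) nr nc"
    by (rule abelian_group_mat)
  show ?thesis
    using assms(1,2)
  proof (induction S)
    case empty
    show ?case using assms(3,4) by (simp add: module_mat_simps)
  next
    case (insert x S)
    then have "mat_sum nr nc f (insert x S) = f x + mat_sum nr nc f S"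
      by (subst finsum_insert) (auto simp: module_mat_simps)
    moreover have "mat_sum nr nc f S \<in> carrier_mat nr nc"
      using insert.prems by (intro mat_sum_carrier) auto
    ultimately show ?case
      using insert assms(3,4) by auto
  qed
qed

lemma index_mult_mat_sum:
  assumes "finite S" and "\<And>x. x \<in> S \<Longrightarrow> f x \<in> carrier_mat nr nc"
    and "P \<in> carrier_mat d nr" and "i < d" "j < nc"
  shows "(P * mat_sum nr nc f S) $$ (i, j) = (\<Sum>x\<in>S. (P * f x) $$ (i, j))"
proof -
  have "mat_sum nr nc f S \<in> carrier_mat nr nc"
    using assms(2) by (rule mat_sum_carrier)
  then have "(P * mat_sum nr nc f S) $$ (i, j) =
      (\<Sum>p = 0..<nr. P $$ (i, p) * (\<Sum>x\<in>S. f x $$ (p, j)))"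
    using assms by (auto simp: scalar_prod_def index_mat_sum intro!: sum.cong)
  also have "\<dots> = (\<Sum>x\<in>S. \<Sum>p = 0..<nr. P $$ (i, p) * f x $$ (p, j))"
    unfolding sum_distrib_left by (rule sum.swap)
  also have "\<dots> = (\<Sum>x\<in>S. (P * f x) $$ (i, j))"
  proof (rule sum.cong[OF refl])
    fix x assume "x \<in> S"
    then have "f x \<in> carrier_mat nr nc" by (rule assms(2))
    then show "(\<Sum>p = 0..<nr. P $$ (i, p) * f x $$ (p, j)) = (P * f x) $$ (i, j)"
      using assms by (auto simp: scalar_prod_def)
  qed
  finally show ?thesis .
qed

lemma Q_seqD:
  assumes "\<alpha> \<in> set (Q_seq n k)"
  shows "length \<alpha> = k" "sorted \<alpha>" "distinct \<alpha>" "set \<alpha> \<subseteq> {..<n}"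
  using assms by (auto simp: set_Q_seq strict_sorted_iff)

lemma Q_seq_nth: "r < n choose k \<Longrightarrow> Q_seq n k ! r \<in> set (Q_seq n k)"
  by (simp add: length_Q_seq)

text \<open>
  The matrices \<open>basis_compound n \<alpha>\<close> have exactly \<open>k\<close> columns, so that there is a single column
  index for their \<open>k\<close>-th compound.
\<close>

lemma Q_seq_full: "Q_seq k k = [[0..<k]]"
proof -
  have "\<alpha> = [0..<k]" if "\<alpha> \<in> set (Q_seq k k)" for \<alpha>
  proof (rule sorted_distinct_set_unique)
    show "set \<alpha> = set [0..<k]"
      using Q_seqD[OF that] by (intro card_subset_eq) (auto simp: distinct_card atLeast0LessThan)
  qed (use Q_seqD[OF that] in auto)
  moreover have "length (Q_seq k k) = 1"
    by (simp add: length_Q_seq)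
  ultimately show ?thesis
    by (cases "Q_seq k k") auto
qed

text \<open>
  For \<open>\<gamma> = \<alpha>\<close> the submatrix is the identity. Otherwise \<open>\<gamma>\<close> and \<open>\<alpha>\<close> differ as sets, because
  both are increasing, and an entry of \<open>\<gamma>\<close> outside \<open>\<alpha>\<close> gives a zero row.
\<close>

lemma minor_of_basis:
  assumes \<alpha>: "\<alpha> \<in> set (Q_seq n k)" and \<gamma>: "\<gamma> \<in> set (Q_seq n k)"
  shows "minor (mat_of_cols n (map (unit_vec n) \<alpha>)) \<gamma> [0..<k] = (if \<gamma> = \<alpha> then 1 else (0::real))"
proof -
  let ?D = "mat k k (\<lambda>(i, j). if \<gamma> ! i = \<alpha> ! j then 1 else (0::real))"
  note a = Q_seqD[OF \<alpha>] and g = Q_seqD[OF \<gamma>]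
  have lt: "\<alpha> ! i < n" "\<gamma> ! i < n" if "i < k" for i
    using that a g by (auto simp: subset_iff)
  have "minor (mat_of_cols n (map (unit_vec n) \<alpha>)) \<gamma> [0..<k] = det ?D"
    unfolding minor_def using a g lt
    by (intro arg_cong[of _ _ det] eq_matI) (auto simp: mat_of_cols_def)
  also have "\<dots> = (if \<gamma> = \<alpha> then 1 else 0)"
  proof (cases "\<gamma> = \<alpha>")
    case True
    then have "?D = 1\<^sub>m k"
      using a by (intro eq_matI) (auto simp: nth_eq_iff_index_eq)
    with True show ?thesis by simp
  next
    case False
    have "set \<gamma> \<noteq> set \<alpha>"
      using False a g sorted_distinct_set_unique by blast
    then have "\<not> set \<gamma> \<subseteq> set \<alpha>"
      using a g card_subset_eq[of "set \<alpha>" "set \<gamma>"] by (auto simp: distinct_card)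
    then obtain i where i: "i < k" "\<gamma> ! i \<notin> set \<alpha>"
      using g by (auto simp: in_set_conv_nth subset_iff)
    have "det ?D = 0"
      unfolding det_def'[OF mat_carrier]
    proof (rule sum.neutral, rule ballI)
      fix p assume "p \<in> {p. p permutes {0..<k}}"
      then have "p i < k"
        using i(1) permutes_in_image[of p "{0..<k}" i] by simp
      then have "?D $$ (i, p i) = 0"
        using i a(1) nth_mem[of "p i" \<alpha>] by auto
      then have "(\<Prod>j = 0..<k. ?D $$ (j, p j)) = 0"
        using i(1) by (intro prod_zero) auto
      then show "signof p * (\<Prod>j = 0..<k. ?D $$ (j, p j)) = 0"
        by simp
    qed
    with False show ?thesis by simp
  qed
  finally show ?thesis .
qed

text \<open>
  Thus the compounds of the basis tuples are the canonical basis of the compound space, in the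
  order of \<open>Q_seq\<close>.
\<close>

lemma index_basis_compound:
  assumes "\<alpha> \<in> set (Q_seq n k)" and "r < n choose k"
  shows "basis_compound n \<alpha> $$ (r, 0) = (if \<alpha> = Q_seq n k ! r then 1 else 0)"
  using assms Q_seqD[OF assms(1)] minor_of_basis[OF assms(1) Q_seq_nth[OF assms(2)]]
  by (auto simp: basis_compound_def mult_compound_def Q_seq_full)

text \<open>
  So \<open>L_mat\<close> reads off the coordinates of a tensor at the increasing index sequences.
\<close>

lemma index_L_mat:
  assumes "r < n choose k" and "p < n ^ k"
  shows "L_mat n k $$ (r, p) = basis_kron n (Q_seq n k ! r) $$ (p, 0)"
proof -
  have dims: "basis_compound n \<alpha> \<in> carrier_mat (n choose k) 1" "basis_kron n \<alpha> \<in> carrier_mat (n ^ k) 1"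
    if "\<alpha> \<in> set (Q_seq n k)" for \<alpha>
    using basis_compound_carrier[of n \<alpha>] basis_kron_carrier[of n \<alpha>] Q_seqD(1)[OF that] by auto
  have "L_mat n k $$ (r, p) =
      (\<Sum>\<alpha>\<in>set (Q_seq n k). (basis_compound n \<alpha> * (basis_kron n \<alpha>)\<^sup>T) $$ (r, p))"
    unfolding L_mat_def using assms
    by (intro index_mat_sum) (auto intro!: mult_carrier_mat[OF dims(1)] transpose_carrier_mat[THEN iffD2] dims(2))
  also have "\<dots> = (\<Sum>\<alpha>\<in>set (Q_seq n k).
      if \<alpha> = Q_seq n k ! r then basis_kron n \<alpha> $$ (p, 0) else 0)"
  proof (rule sum.cong[OF refl])
    fix \<alpha> assume *: "\<alpha> \<in> set (Q_seq n k)"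
    show "(basis_compound n \<alpha> * (basis_kron n \<alpha>)\<^sup>T) $$ (r, p) =
        (if \<alpha> = Q_seq n k ! r then basis_kron n \<alpha> $$ (p, 0) else 0)"
      using assms dims[OF *] index_basis_compound[OF * assms(1)] by (auto simp: scalar_prod_def)
  qed
  also have "\<dots> = basis_kron n (Q_seq n k ! r) $$ (p, 0)"
    using Q_seq_nth[OF assms(1)] by simp
  finally show ?thesis .
qed

text \<open>
  So \<open>M_mat\<close> sends a basis vector of the compound space to the alternating sum of the tensors
  \<open>basis_kron n \<beta>\<close> over all rearrangements \<open>\<beta>\<close> of its index sequence.
\<close>

lemma index_M_mat:
  assumes "c < n choose k" and "p < n ^ k"
  shows "M_mat n k $$ (p, c) =
    (\<Sum>\<beta>\<in>permutations_of_multiset (mset (Q_seq n k ! c)).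
      of_int (signature \<beta>) * basis_kron n \<beta> $$ (p, 0))"
proof -
  let ?P = "\<lambda>\<alpha>. permutations_of_multiset (mset \<alpha>)"
  let ?t = "\<lambda>\<alpha> \<beta>. of_int (signature \<beta>) \<cdot>\<^sub>m (basis_kron n \<beta> * (basis_compound n \<alpha>)\<^sup>T)"
  have dims: "basis_compound n \<alpha> \<in> carrier_mat (n choose k) 1" "basis_kron n \<beta> \<in> carrier_mat (n ^ k) 1"
    if "\<alpha> \<in> set (Q_seq n k)" "\<beta> \<in> ?P \<alpha>" for \<alpha> \<beta>
    using basis_compound_carrier[of n \<alpha>] basis_kron_carrier[of n \<beta>] Q_seqD(1)[OF that(1)]
      permutations_of_multisetD[OF that(2), THEN mset_eq_length] by auto
  have summand: "?t \<alpha> \<beta> \<in> carrier_mat (n ^ k) (n choose k)"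
    if "\<alpha> \<in> set (Q_seq n k)" "\<beta> \<in> ?P \<alpha>" for \<alpha> \<beta>
    using dims[OF that] by auto
  have "M_mat n k $$ (p, c) =
      (\<Sum>\<alpha>\<in>set (Q_seq n k). mat_sum (n ^ k) (n choose k) (?t \<alpha>) (?P \<alpha>) $$ (p, c))"
    unfolding M_mat_def using assms summand
    by (intro index_mat_sum) (auto intro!: mat_sum_carrier)
  also have "\<dots> = (\<Sum>\<alpha>\<in>set (Q_seq n k). \<Sum>\<beta>\<in>?P \<alpha>. ?t \<alpha> \<beta> $$ (p, c))"
    using assms summand by (intro sum.cong[OF refl] index_mat_sum) auto
  also have "\<dots> = (\<Sum>\<alpha>\<in>set (Q_seq n k). if \<alpha> = Q_seq n k ! c
      then \<Sum>\<beta>\<in>?P \<alpha>. of_int (signature \<beta>) * basis_kron n \<beta> $$ (p, 0) else 0)"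
  proof (rule sum.cong[OF refl])
    fix \<alpha> assume *: "\<alpha> \<in> set (Q_seq n k)"
    have "?t \<alpha> \<beta> $$ (p, c) = (if \<alpha> = Q_seq n k ! c
        then of_int (signature \<beta>) * basis_kron n \<beta> $$ (p, 0) else 0)" if "\<beta> \<in> ?P \<alpha>" for \<beta>
      using assms dims[OF * that] index_basis_compound[OF * assms(1)] by (auto simp: scalar_prod_def)
    then show "(\<Sum>\<beta>\<in>?P \<alpha>. ?t \<alpha> \<beta> $$ (p, c)) = (if \<alpha> = Q_seq n k ! c
        then \<Sum>\<beta>\<in>?P \<alpha>. of_int (signature \<beta>) * basis_kron n \<beta> $$ (p, 0) else 0)"
      by simp
  qed
  also have "\<dots> = (\<Sum>\<beta>\<in>?P (Q_seq n k ! c). of_int (signature \<beta>) * basis_kron n \<beta> $$ (p, 0))"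
    using Q_seq_nth[OF assms(1)] by simp
  finally show ?thesis .
qed

text \<open>
  Between \<open>L_mat\<close> and \<open>M_mat\<close>, a matrix on tensors enters only through its matrix elements between
  basis tensors.
\<close>

lemma index_L_mult_M:
  assumes P: "P \<in> carrier_mat (n ^ k) (n ^ k)" and r: "r < n choose k" and c: "c < n choose k"
  shows "(L_mat n k * (P * M_mat n k)) $$ (r, c) =
    (\<Sum>\<beta>\<in>permutations_of_multiset (mset (Q_seq n k ! c)). of_int (signature \<beta>) *
      ((basis_kron n (Q_seq n k ! r))\<^sup>T * (P * basis_kron n \<beta>)) $$ (0, 0))"
proof -
  let ?\<alpha> = "Q_seq n k ! r" and ?S = "permutations_of_multiset (mset (Q_seq n k ! c))"
  let ?N = "n ^ k"
  note L = L_mat_carrier[of n k] and M = M_mat_carrier[of n k]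
  have \<alpha>: "basis_kron n ?\<alpha> \<in> carrier_mat ?N 1"
    using basis_kron_carrier[of n ?\<alpha>] Q_seqD(1)[OF Q_seq_nth[OF r]] by simp
  have \<beta>: "basis_kron n \<beta> \<in> carrier_mat ?N 1" if "\<beta> \<in> ?S" for \<beta>
    using basis_kron_carrier[of n \<beta>] Q_seqD(1)[OF Q_seq_nth[OF c]]
      permutations_of_multisetD[OF that, THEN mset_eq_length] by simp
  have "(L_mat n k * (P * M_mat n k)) $$ (r, c) =
      (\<Sum>p = 0..<?N. L_mat n k $$ (r, p) * (\<Sum>q = 0..<?N. P $$ (p, q) * M_mat n k $$ (q, c)))"
    using L M P r c by (simp add: scalar_prod_def)
  also have "\<dots> = (\<Sum>p = 0..<?N. basis_kron n ?\<alpha> $$ (p, 0) * (\<Sum>q = 0..<?N. P $$ (p, q) *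
      (\<Sum>\<beta>\<in>?S. of_int (signature \<beta>) * basis_kron n \<beta> $$ (q, 0))))"
    using r c by (simp add: index_L_mat index_M_mat)
  also have "\<dots> = (\<Sum>p = 0..<?N. \<Sum>q = 0..<?N. \<Sum>\<beta>\<in>?S.
      of_int (signature \<beta>) * (basis_kron n ?\<alpha> $$ (p, 0) * (P $$ (p, q) * basis_kron n \<beta> $$ (q, 0))))"
    by (simp add: sum_distrib_left ac_simps)
  also have "\<dots> = (\<Sum>p = 0..<?N. \<Sum>\<beta>\<in>?S. \<Sum>q = 0..<?N.
      of_int (signature \<beta>) * (basis_kron n ?\<alpha> $$ (p, 0) * (P $$ (p, q) * basis_kron n \<beta> $$ (q, 0))))"
    by (intro sum.cong[OF refl] sum.swap)
  also have "\<dots> = (\<Sum>\<beta>\<in>?S. \<Sum>p = 0..<?N. \<Sum>q = 0..<?N.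
      of_int (signature \<beta>) * (basis_kron n ?\<alpha> $$ (p, 0) * (P $$ (p, q) * basis_kron n \<beta> $$ (q, 0))))"
    by (rule sum.swap)
  also have "\<dots> = (\<Sum>\<beta>\<in>?S. of_int (signature \<beta>) *
      ((basis_kron n ?\<alpha>)\<^sup>T * (P * basis_kron n \<beta>)) $$ (0, 0))"
  proof (rule sum.cong[OF refl])
    fix \<beta> assume "\<beta> \<in> ?S"
    from \<beta>[OF this] have "((basis_kron n ?\<alpha>)\<^sup>T * (P * basis_kron n \<beta>)) $$ (0, 0) =
      (\<Sum>p = 0..<?N. basis_kron n ?\<alpha> $$ (p, 0) * (\<Sum>q = 0..<?N. P $$ (p, q) * basis_kron n \<beta> $$ (q, 0)))"
      using \<alpha> P by (simp add: scalar_prod_def)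
    then show "(\<Sum>p = 0..<?N. \<Sum>q = 0..<?N.
      of_int (signature \<beta>) * (basis_kron n ?\<alpha> $$ (p, 0) * (P $$ (p, q) * basis_kron n \<beta> $$ (q, 0)))) =
      of_int (signature \<beta>) * ((basis_kron n ?\<alpha>)\<^sup>T * (P * basis_kron n \<beta>)) $$ (0, 0)"
      by (simp add: sum_distrib_left)
  qed
  finally show ?thesis .
qed

section \<open>Rearrangements and signs\<close>

text \<open>
  The rearrangements of an increasing sequence correspond bijectively to the permutations of its
  positions, and under this correspondence \<open>signature\<close> becomes the sign of a permutation.
\<close>

lemma sum_rearrangements:
  fixes \<beta> :: "nat list" and f :: "int \<Rightarrow> nat list \<Rightarrow> 'a :: comm_monoid_add"
  assumes "sorted \<beta>" and "distinct \<beta>"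
  shows "(\<Sum>\<xi>\<in>permutations_of_multiset (mset \<beta>). f (signature \<xi>) \<xi>) =
    (\<Sum>p | p permutes {0..<length \<beta>}. f (sign p) (permute_list p \<beta>))"
proof -
  let ?Perm = "{p. p permutes {0..<length \<beta>}}"
  have perm: "permute_list p \<beta> \<in> permutations_of_multiset (mset \<beta>)" if "p \<in> ?Perm" for p
    using that by (simp add: permutations_of_multiset_def atLeast0LessThan)
  have unique: "\<exists>!p. p permutes {0..<length \<beta>} \<and> permute_list p \<beta> = \<xi>"
    if "\<xi> \<in> permutations_of_multiset (mset \<beta>)" for \<xi>
  proof -
    have eq: "mset \<xi> = mset \<beta>"
      using that by (rule permutations_of_multisetD)
    then have "sort \<xi> = \<beta>" "length \<xi> = length \<beta>" "distinct \<xi>"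
      using assms properties_for_sort[of \<beta> \<xi>] mset_eq_length mset_eq_imp_distinct_iff by auto
    with signature_perm_unique[of \<xi>] show ?thesis
      by (simp add: atLeast0LessThan)
  qed
  \<comment> \<open>Existence in \<open>unique\<close> makes this map surjective, uniqueness makes it injective.\<close>
  have bij: "bij_betw (\<lambda>p. permute_list p \<beta>) ?Perm (permutations_of_multiset (mset \<beta>))"
    unfolding bij_betw_def
  proof
    show "inj_on (\<lambda>p. permute_list p \<beta>) ?Perm"
      using unique[OF perm] by (intro inj_onI) blast
    show "(\<lambda>p. permute_list p \<beta>) ` ?Perm = permutations_of_multiset (mset \<beta>)"
    proof
      show "(\<lambda>p. permute_list p \<beta>) ` ?Perm \<subseteq> permutations_of_multiset (mset \<beta>)"
        using perm by blast
      show "permutations_of_multiset (mset \<beta>) \<subseteq> (\<lambda>p. permute_list p \<beta>) ` ?Perm"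
        using unique by blast
    qed
  qed
  have sgn: "signature (permute_list p \<beta>) = sign p" if "p \<in> ?Perm" for p
  proof -
    have "mset (permute_list p \<beta>) = mset \<beta>"
      using that by (simp add: atLeast0LessThan)
    then have "sort (permute_list p \<beta>) = \<beta>"
      using assms(1) by (metis properties_for_sort)
    moreover have "(THE q. q permutes {..<length \<beta>} \<and> permute_list q \<beta> = permute_list p \<beta>) = p"
      using that unique[OF perm[OF that]] by (intro the1_equality) (auto simp: atLeast0LessThan)
    ultimately show ?thesis
      by (simp add: signature_def)
  qed
  show ?thesis
    using sgn by (simp add: sum.reindex_bij_betw[OF bij, symmetric])
qed

text \<open>
  The cycle that puts \<open>l\<close> in front of \<open>0, \<dots>, l - 1\<close>. It is where the factor \<open>(-1) ^ l\<close> comes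
  from.
\<close>

lemma permutation_insert_front:
  assumes "l < Suc n"
  shows "permutation_insert 0 l id permutes {0..<Suc n}"
    and "sign (permutation_insert 0 l id) = (-1) ^ l"
    and "permutation_insert 0 l id 0 = l"
    and "permutation_insert 0 l id (Suc i) = (if i < l then i else Suc i)"
proof -
  have id: "id permutes {0..<n}"
    by (rule permutes_id)
  show "permutation_insert 0 l id permutes {0..<Suc n}"
    using permutation_insert_permutes[OF id _ assms, of 0] by simp
  show "sign (permutation_insert 0 l id) = (-1) ^ l"
    using signof_permutation_insert[OF id _ assms, of 0, where 'a = int] by simp
  show "permutation_insert 0 l id 0 = l"
    by simp
  show "permutation_insert 0 l id (Suc i) = (if i < l then i else Suc i)"
    by (simp add: permutation_insert_expand)
qed

text \<open>
  In a nonzero term on the left, \<open>\<beta> \<circ> p\<close> is a rearrangement that agrees with \<open>\<alpha>\<close> except possibly at position \<open>l\<close>.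
  Moving its entry at position \<open>l\<close> to the front turns it into a rearrangement \<open>\<xi>\<close> whose tail is \<open>\<alpha>\<close>
  without its entry at position \<open>l\<close>, and multiplies the sign by \<open>(-1) ^ l\<close>.
\<close>

lemma sum_minor_terms_eq_rearrangements:
  fixes \<alpha> \<beta> :: "nat list" and F :: "nat \<Rightarrow> real"
  assumes "sorted \<beta>" "distinct \<beta>" "length \<beta> = k" "length \<alpha> = k" and l: "l < k"
  shows "(\<Sum>p | p permutes {0..<k}. of_int (sign p) *
      (F (\<beta> ! p l) * (\<Prod>i\<in>{0..<k} - {l}. if \<alpha> ! i = \<beta> ! p i then 1 else 0))) =
    (-1) ^ l * (\<Sum>\<xi>\<in>permutations_of_multiset (mset \<beta>). of_int (signature \<xi>) *
      (if take l \<alpha> @ drop (Suc l) \<alpha> = tl \<xi> then F (hd \<xi>) else 0))"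
proof -
  obtain n where n: "k = Suc n"
    using l by (cases k) auto
  define \<tau> where "\<tau> = permutation_insert 0 l id"
  note \<tau> = permutation_insert_front[of l n, folded \<tau>_def]
  have \<tau>_perm: "\<tau> permutes {0..<k}"
    using \<tau>(1) l n by simp
  have \<tau>_perm': "\<tau> permutes {..<k}"
    using \<tau>_perm by (simp add: atLeast0LessThan)
  have \<tau>_range: "\<tau> ` {Suc 0..<k} = {0..<k} - {l}"
  proof -
    have "{Suc 0..<k} = {0..<k} - {0}" by auto
    then show ?thesis
      using \<tau>(3) l n permutes_image[OF \<tau>_perm] permutes_inj[OF \<tau>_perm]
      by (simp add: image_set_diff)
  qed
  have eq: "of_int (sign (p \<circ> \<tau>)) * (if take l \<alpha> @ drop (Suc l) \<alpha> = tl (permute_list (p \<circ> \<tau>) \<beta>)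
        then F (hd (permute_list (p \<circ> \<tau>) \<beta>)) else 0) =
      (-1) ^ l * (of_int (sign p) *
        (F (\<beta> ! p l) * (\<Prod>i\<in>{0..<k} - {l}. if \<alpha> ! i = \<beta> ! p i then 1 else 0)))"
    if p: "p permutes {0..<k}" for p
  proof -
    have p': "p permutes {..<k}"
      using p by (simp add: atLeast0LessThan)
    have perm: "(p \<circ> \<tau>) permutes {..<length \<beta>}"
      using permutes_compose[OF \<tau>_perm' p'] assms(3) by simp
    note nth = permute_list_nth[OF perm]
    have "permutation p" "permutation \<tau>"
      using p \<tau>_perm by (auto intro: permutation_permutes[THEN iffD2])
    then have sgn: "sign (p \<circ> \<tau>) = sign p * (-1) ^ l"
      using \<tau>(2) l n by (simp add: sign_compose)
    have ne: "permute_list (p \<circ> \<tau>) \<beta> \<noteq> []"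
      using assms(3) n by (auto simp: permute_list_def)
    have hd: "hd (permute_list (p \<circ> \<tau>) \<beta>) = \<beta> ! p l"
      using ne nth[of 0] \<tau>(3) assms(3) l n by (simp add: hd_conv_nth)
    have del: "(take l \<alpha> @ drop (Suc l) \<alpha>) ! i = \<alpha> ! \<tau> (Suc i)" if "i < n" for i
      using that \<tau>(4) assms(4) l n by (auto simp: nth_append)
    have "take l \<alpha> @ drop (Suc l) \<alpha> = tl (permute_list (p \<circ> \<tau>) \<beta>) \<longleftrightarrow>
        (\<forall>i<n. \<alpha> ! \<tau> (Suc i) = \<beta> ! p (\<tau> (Suc i)))"
      using assms(3,4) l n del nth by (auto simp: list_eq_iff_nth_eq nth_tl)
    also have "\<dots> \<longleftrightarrow> (\<forall>i\<in>{Suc 0..<k}. \<alpha> ! \<tau> i = \<beta> ! p (\<tau> i))"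
      using n by (auto simp: Suc_le_eq gr0_conv_Suc)
    also have "\<dots> \<longleftrightarrow> (\<forall>i\<in>\<tau> ` {Suc 0..<k}. \<alpha> ! i = \<beta> ! p i)"
      by blast
    finally have match: "take l \<alpha> @ drop (Suc l) \<alpha> = tl (permute_list (p \<circ> \<tau>) \<beta>) \<longleftrightarrow>
        (\<forall>i\<in>{0..<k} - {l}. \<alpha> ! i = \<beta> ! p i)"
      unfolding \<tau>_range .
    have prod: "(\<Prod>i\<in>{0..<k} - {l}. if \<alpha> ! i = \<beta> ! p i then 1 else 0) =
        (if \<forall>i\<in>{0..<k} - {l}. \<alpha> ! i = \<beta> ! p i then 1 else (0::real))"
      by (auto intro: prod.neutral)
    show ?thesis
      unfolding match hd sgn prod by simp
  qed
  have "(\<Sum>\<xi>\<in>permutations_of_multiset (mset \<beta>). of_int (signature \<xi>) *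
      (if take l \<alpha> @ drop (Suc l) \<alpha> = tl \<xi> then F (hd \<xi>) else 0)) =
    (\<Sum>p | p permutes {0..<k}. of_int (sign p) *
      (if take l \<alpha> @ drop (Suc l) \<alpha> = tl (permute_list p \<beta>) then F (hd (permute_list p \<beta>)) else 0))"
    using sum_rearrangements[OF assms(1,2), of "\<lambda>s \<xi>. of_int s *
      (if take l \<alpha> @ drop (Suc l) \<alpha> = tl \<xi> then F (hd \<xi>) else 0)"] assms(3) by simp
  also have "\<dots> = (\<Sum>p | p permutes {0..<k}. (-1) ^ l * (of_int (sign p) *
      (F (\<beta> ! p l) * (\<Prod>i\<in>{0..<k} - {l}. if \<alpha> ! i = \<beta> ! p i then 1 else 0))))"
    by (rule trans[OF sum_permutations_compose_right[OF \<tau>_perm] sum.cong[OF refl]]) (use eq in auto)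
  finally show ?thesis
    by (simp add: sum_distrib_left flip: mult.assoc power_add)
qed

section \<open>Entries of the additive compound\<close>

lemma coeff_1_prod_linear:
  fixes a b :: "'i \<Rightarrow> real"
  shows "coeff (\<Prod>i\<in>S. [:a i, b i:]) 1 = (\<Sum>l\<in>S. b l * (\<Prod>i\<in>S - {l}. a i))"
proof -
  have "coeff (\<Prod>i\<in>S. [:a i, b i:]) 1 = poly (pderiv (\<Prod>i\<in>S. [:a i, b i:])) 0"
    by (simp add: poly_0_coeff_0 coeff_pderiv)
  also have "\<dots> = (\<Sum>l\<in>S. b l * (\<Prod>i\<in>S - {l}. a i))"
    by (simp add: pderiv_prod pderiv_pCons poly_sum poly_prod mult.commute)
  finally show ?thesis .
qed

lemma coeff_of_int_mult: "coeff (of_int z * p) i = of_int z * coeff p i"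
  for p :: "'a :: comm_ring_1 poly"
  by (simp add: of_int_poly)

text \<open>
  In the Leibniz expansion of the minor every factor is linear in the indeterminate: a Kronecker
  delta plus an entry of \<open>C\<close> times the indeterminate. The linear coefficient of such a product
  takes the entry of \<open>C\<close> from one position \<open>l\<close> and the deltas from all others.
\<close>

lemma coeff_1_minor:
  fixes C :: "real mat"
  assumes "C \<in> carrier_mat n n" and "length \<alpha> = k" "length \<beta> = k"
    and "set \<alpha> \<subseteq> {..<n}" "set \<beta> \<subseteq> {..<n}"
  shows "coeff (minor (1\<^sub>m n + [:0, 1:] \<cdot>\<^sub>m map_mat (\<lambda>c. [:c:]) C) \<alpha> \<beta>) 1 =
    (\<Sum>l<k. \<Sum>p | p permutes {0..<k}. of_int (sign p) *
      (C $$ (\<alpha> ! l, \<beta> ! p l) * (\<Prod>i\<in>{0..<k} - {l}. if \<alpha> ! i = \<beta> ! p i then 1 else 0)))"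
proof -
  let ?D = "mat k k (\<lambda>(i, j). [:if \<alpha> ! i = \<beta> ! j then 1 else 0, C $$ (\<alpha> ! i, \<beta> ! j):])"
  have lt: "\<alpha> ! i < n" "\<beta> ! i < n" if "i < k" for i
    using that assms by (auto simp: subset_iff)
  have "minor (1\<^sub>m n + [:0, 1:] \<cdot>\<^sub>m map_mat (\<lambda>c. [:c:]) C) \<alpha> \<beta> = det ?D"
    unfolding minor_def using assms lt
    by (intro arg_cong[of _ _ det] eq_matI) (auto simp: one_pCons)
  also have "\<dots> = (\<Sum>p | p permutes {0..<k}. of_int (sign p) *
      (\<Prod>i = 0..<k. [:if \<alpha> ! i = \<beta> ! p i then 1 else 0, C $$ (\<alpha> ! i, \<beta> ! p i):]))"
    by (subst det_def'[of _ k]) (auto intro!: sum.cong prod.cong simp: permutes_in_image[where S = "{0..<k}", simplified])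
  finally have "coeff (minor (1\<^sub>m n + [:0, 1:] \<cdot>\<^sub>m map_mat (\<lambda>c. [:c:]) C) \<alpha> \<beta>) 1 =
      (\<Sum>p | p permutes {0..<k}. of_int (sign p) * (\<Sum>l = 0..<k. C $$ (\<alpha> ! l, \<beta> ! p l) *
        (\<Prod>i\<in>{0..<k} - {l}. if \<alpha> ! i = \<beta> ! p i then 1 else 0)))"
    by (simp only: coeff_sum coeff_of_int_mult coeff_1_prod_linear)
  also have "\<dots> = (\<Sum>p | p permutes {0..<k}. \<Sum>l<k. of_int (sign p) * (C $$ (\<alpha> ! l, \<beta> ! p l) *
        (\<Prod>i\<in>{0..<k} - {l}. if \<alpha> ! i = \<beta> ! p i then 1 else 0)))"
    by (simp add: sum_distrib_left atLeast0LessThan)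
  also have "\<dots> = (\<Sum>l<k. \<Sum>p | p permutes {0..<k}. of_int (sign p) * (C $$ (\<alpha> ! l, \<beta> ! p l) *
        (\<Prod>i\<in>{0..<k} - {l}. if \<alpha> ! i = \<beta> ! p i then 1 else 0)))"
    by (rule sum.swap)
  finally show ?thesis .
qed

text \<open>
  This form of the entries uses rearrangements with the distinguished index in front, which is how
  they arise from the contraction in the first tensor slot.
\<close>

lemma index_add_compound:
  fixes C :: "real mat"
  assumes C: "C \<in> carrier_mat n n" and r: "r < n choose k" and c: "c < n choose k"
  defines "\<alpha> \<equiv> Q_seq n k ! r" and "\<beta> \<equiv> Q_seq n k ! c"
  shows "add_compound k C $$ (r, c) = (\<Sum>l<k. (-1) ^ l *
    (\<Sum>\<xi>\<in>permutations_of_multiset (mset \<beta>). of_int (signature \<xi>) *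
      (if take l \<alpha> @ drop (Suc l) \<alpha> = tl \<xi> then C $$ (\<alpha> ! l, hd \<xi>) else 0)))"
proof -
  note \<alpha> = Q_seqD[OF Q_seq_nth[OF r], folded \<alpha>_def]
    and \<beta> = Q_seqD[OF Q_seq_nth[OF c], folded \<beta>_def]
  have "add_compound k C $$ (r, c) =
      coeff (minor (1\<^sub>m n + [:0, 1:] \<cdot>\<^sub>m map_mat (\<lambda>c. [:c:]) C) \<alpha> \<beta>) 1"
    using C r c by (simp add: add_compound_def mult_compound_def \<alpha>_def \<beta>_def)
  also have "\<dots> = (\<Sum>l<k. \<Sum>p | p permutes {0..<k}. of_int (sign p) *
      (C $$ (\<alpha> ! l, \<beta> ! p l) * (\<Prod>i\<in>{0..<k} - {l}. if \<alpha> ! i = \<beta> ! p i then 1 else 0)))"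
    by (rule coeff_1_minor[OF C \<alpha>(1) \<beta>(1) \<alpha>(4) \<beta>(4)])
  also have "\<dots> = (\<Sum>l<k. (-1) ^ l *
    (\<Sum>\<xi>\<in>permutations_of_multiset (mset \<beta>). of_int (signature \<xi>) *
      (if take l \<alpha> @ drop (Suc l) \<alpha> = tl \<xi> then C $$ (\<alpha> ! l, hd \<xi>) else 0)))"
    by (rule sum.cong[OF refl], rule sum_minor_terms_eq_rearrangements[OF \<beta>(2,3,1) \<alpha>(1)]) simp
  finally show ?thesis .
qed

section \<open>The representation of the additive compound\<close>

text \<open>
  The contraction turns \<open>\<beta>\<close> into \<open>tl \<beta>\<close> at the cost of the factor \<open>v $ hd \<beta>\<close>; the insertion puts
  \<open>w\<close> at position \<open>l\<close>. The coordinate at \<open>\<alpha>\<close> of the result is \<open>w $ (\<alpha> ! l)\<close> if the other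
  positions match and 0 if not. Positions start at 0 here, so \<open>Suc l\<close> is the slot for \<open>H_mat\<close>.
\<close>

lemma matrix_element_of_insertion_and_contraction:
  assumes w: "w \<in> carrier_vec n" and v: "v \<in> carrier_vec n"
    and \<alpha>: "length \<alpha> = k" "set \<alpha> \<subseteq> {..<n}" and \<beta>: "length \<beta> = k" "set \<beta> \<subseteq> {..<n}"
    and l: "l < k"
  shows "((basis_kron n \<alpha>)\<^sup>T *
      (H_mat n k (Suc l) ((col_vector w)\<^sup>T) * H_mat n k 1 (col_vector v) * basis_kron n \<beta>)) $$ (0, 0) =
    (if take l \<alpha> @ drop (Suc l) \<alpha> = tl \<beta> then w $ (\<alpha> ! l) * v $ hd \<beta> else 0)"
proof -
  obtain b \<gamma> where b: "\<beta> = b # \<gamma>"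
    using \<beta>(1) l by (cases \<beta>) auto
  define \<gamma>1 \<gamma>2 where "\<gamma>1 = take l \<gamma>" and "\<gamma>2 = drop l \<gamma>"
  have \<gamma>: "\<gamma> = \<gamma>1 @ \<gamma>2" "length \<gamma>1 = l" "length \<gamma>2 = k - Suc l"
    using \<beta>(1) b l by (auto simp: \<gamma>1_def \<gamma>2_def)
  have \<alpha>_split: "\<alpha> = take l \<alpha> @ \<alpha> ! l # drop (Suc l) \<alpha>"
    using \<alpha>(1) l by (simp add: id_take_nth_drop)
  let ?Hw = "H_mat n k (Suc l) ((col_vector w)\<^sup>T)" and ?Hv = "H_mat n k 1 (col_vector v)"
  let ?T = "kron_list (map (basis_col n) \<gamma>1 @ col_vector w # map (basis_col n) \<gamma>2)"
  have Hw: "?Hw \<in> carrier_mat (n ^ k) (n ^ (k - 1))"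
    using w l by (intro H_mat_row_carrier) auto
  have Hv: "?Hv \<in> carrier_mat (n ^ (k - 1)) (n ^ k)"
    using v l by (intro H_mat_col_carrier) auto
  have A: "basis_kron n \<alpha> \<in> carrier_mat (n ^ k) 1" and B: "basis_kron n \<beta> \<in> carrier_mat (n ^ k) 1"
    using basis_kron_carrier[of n \<alpha>] basis_kron_carrier[of n \<beta>] \<alpha>(1) \<beta>(1) by simp_all
  have "length \<gamma> = k - 1"
    using \<beta>(1) b by auto
  then have G: "basis_kron n \<gamma> \<in> carrier_mat (n ^ (k - 1)) 1"
    using basis_kron_carrier[of n \<gamma>] by simp
  have "?Hw * ?Hv * basis_kron n \<beta> = ?Hw * (?Hv * basis_kron n \<beta>)"
    by (rule assoc_mult_mat[OF Hw Hv B])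
  also have "?Hv * basis_kron n \<beta> = v $ b \<cdot>\<^sub>m basis_kron n \<gamma>"
    unfolding b using v \<beta> b by (intro contract_first_factor) auto
  also have "?Hw * (v $ b \<cdot>\<^sub>m basis_kron n \<gamma>) = v $ b \<cdot>\<^sub>m (?Hw * basis_kron n \<gamma>)"
    by (rule mult_smult_distrib[OF Hw G])
  also have HwG: "?Hw * basis_kron n \<gamma> = ?T"
    unfolding \<gamma>(1) using w \<gamma>(2,3) l by (intro insert_factor) auto
  finally have eq: "?Hw * ?Hv * basis_kron n \<beta> = v $ b \<cdot>\<^sub>m ?T" .
  have T: "?T \<in> carrier_mat (n ^ k) 1"
    using mult_carrier_mat[OF Hw G] unfolding HwG .
  have "(basis_kron n \<alpha>)\<^sup>T * (v $ b \<cdot>\<^sub>m ?T) = v $ b \<cdot>\<^sub>m ((basis_kron n \<alpha>)\<^sup>T * ?T)"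
    using A T by (intro mult_smult_distrib) auto
  moreover have "((basis_kron n \<alpha>)\<^sup>T * ?T) $$ (0, 0) =
      (if take l \<alpha> = \<gamma>1 \<and> drop (Suc l) \<alpha> = \<gamma>2 then w $ (\<alpha> ! l) else 0)"
  proof (subst \<alpha>_split, rule coordinate_of_inserted[OF w])
    show "\<alpha> ! l < n"
      using \<alpha> l by (auto simp: subset_iff)
    show "set (take l \<alpha>) \<union> set (drop (Suc l) \<alpha>) \<union> set \<gamma>1 \<union> set \<gamma>2 \<subseteq> {..<n}"
      using \<alpha>(2) \<beta>(2) b \<gamma>(1) by (auto dest: in_set_takeD in_set_dropD)
  qed (use \<alpha>(1) \<gamma>(2,3) l in auto)
  moreover have "take l \<alpha> @ drop (Suc l) \<alpha> = tl \<beta> \<longleftrightarrow> take l \<alpha> = \<gamma>1 \<and> drop (Suc l) \<alpha> = \<gamma>2"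
    using b \<gamma> \<alpha>(1) l by simp
  ultimately show ?thesis
    unfolding eq using A T b by (simp add: mult.commute)
qed

theorem theorem7:
  fixes A B :: "real mat" and n m k :: nat
  assumes "n > 1" and "m \<ge> 1"
    and "A \<in> carrier_mat n m" and "B \<in> carrier_mat m n"
    and "k \<in> {1..n}"
  shows "add_compound k (A * B) =
    L_mat n k *
      mat_sum (n ^ k) (n choose k)
        (\<lambda>i. mat_sum (n ^ k) (n choose k)
           (\<lambda>l. (-1 :: real) ^ (l + 1) \<cdot>\<^sub>m
              (H_mat n k l ((col_vector (col A i))\<^sup>T) * H_mat n k 1 (col_vector (row B i)) * M_mat n k))
           {1..k})
        {0..<m}"
    (is "_ = L_mat n k * mat_sum ?N ?d (\<lambda>i. mat_sum ?N ?d (?f i) {1..k}) {0..<m}")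
proof (rule eq_matI)
  note A = assms(3) and B = assms(4) and L = L_mat_carrier[of n k] and M = M_mat_carrier[of n k]
  let ?P = "\<lambda>i l. H_mat n k l ((col_vector (col A i))\<^sup>T) * H_mat n k 1 (col_vector (row B i))"
  have P: "?P i l \<in> carrier_mat ?N ?N" if "l \<in> {1..k}" for i l
    using A B that by (intro mult_carrier_mat[OF H_mat_row_carrier H_mat_col_carrier]) auto
  have f: "?f i l \<in> carrier_mat ?N ?d" if "l \<in> {1..k}" for i l
    by (rule smult_carrier_mat[OF mult_carrier_mat[OF P[OF that] M]])
  have F: "mat_sum ?N ?d (?f i) {1..k} \<in> carrier_mat ?N ?d" for i
    using f by (rule mat_sum_carrier)
  have "mat_sum ?N ?d (\<lambda>i. mat_sum ?N ?d (?f i) {1..k}) {0..<m} \<in> carrier_mat ?N ?d"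
    using F by (rule mat_sum_carrier)
  note R = mult_carrier_mat[OF L this]
  have AB: "A * B \<in> carrier_mat n n"
    using A B by (rule mult_carrier_mat)
  have C: "add_compound k (A * B) \<in> carrier_mat ?d ?d"
    using A B by (simp add: add_compound_def mult_compound_def)
  show "dim_row (add_compound k (A * B)) =
      dim_row (L_mat n k * mat_sum ?N ?d (\<lambda>i. mat_sum ?N ?d (?f i) {1..k}) {0..<m})"
    by (simp only: carrier_matD[OF C] carrier_matD[OF R])
  show "dim_col (add_compound k (A * B)) =
      dim_col (L_mat n k * mat_sum ?N ?d (\<lambda>i. mat_sum ?N ?d (?f i) {1..k}) {0..<m})"
    by (simp only: carrier_matD[OF C] carrier_matD[OF R])
  fix r c
  assume "r < dim_row (L_mat n k * mat_sum ?N ?d (\<lambda>i. mat_sum ?N ?d (?f i) {1..k}) {0..<m})"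
    and "c < dim_col (L_mat n k * mat_sum ?N ?d (\<lambda>i. mat_sum ?N ?d (?f i) {1..k}) {0..<m})"
  then have r: "r < ?d" and c: "c < ?d"
    by (simp_all only: carrier_matD[OF R])
  let ?\<alpha> = "Q_seq n k ! r" and ?S = "permutations_of_multiset (mset (Q_seq n k ! c))"
  note \<alpha> = Q_seqD[OF Q_seq_nth[OF r]] and \<beta> = Q_seqD[OF Q_seq_nth[OF c]]
  have \<xi>: "length \<xi> = k" "set \<xi> \<subseteq> {..<n}" if "\<xi> \<in> ?S" for \<xi>
    using permutations_of_multisetD[OF that] \<beta> by (metis mset_eq_length, metis mset_eq_setD)
  have lt: "?\<alpha> ! l < n" "hd \<xi> < n" if "\<xi> \<in> ?S" "l < k" for \<xi> l
  proof -
    show "?\<alpha> ! l < n"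
      using \<alpha>(1,4) that(2) by (auto simp: subset_iff)
    show "hd \<xi> < n"
      using \<xi>[OF that(1)] that(2) by (cases \<xi>) auto
  qed
  let ?match = "\<lambda>l \<xi>. take l ?\<alpha> @ drop (Suc l) ?\<alpha> = tl \<xi>"
  have summand: "(L_mat n k * ?f i (Suc l)) $$ (r, c) = (-1) ^ l * (\<Sum>\<xi>\<in>?S. of_int (signature \<xi>) *
      (if ?match l \<xi> then A $$ (?\<alpha> ! l, i) * B $$ (i, hd \<xi>) else 0))"
    if "i < m" "l < k" for i l
  proof -
    have l: "Suc l \<in> {1..k}" using that(2) by simp
    have "L_mat n k * ?f i (Suc l) = (-1) ^ (Suc l + 1) \<cdot>\<^sub>m (L_mat n k * (?P i (Suc l) * M_mat n k))"
      by (rule mult_smult_distrib[OF L mult_carrier_mat[OF P[OF l] M]])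
    then have "(L_mat n k * ?f i (Suc l)) $$ (r, c) =
        (-1) ^ l * (L_mat n k * (?P i (Suc l) * M_mat n k)) $$ (r, c)"
      using L M r c by simp
    also have "(L_mat n k * (?P i (Suc l) * M_mat n k)) $$ (r, c) =
        (\<Sum>\<xi>\<in>?S. of_int (signature \<xi>) *
          ((basis_kron n ?\<alpha>)\<^sup>T * (?P i (Suc l) * basis_kron n \<xi>)) $$ (0, 0))"
      by (rule index_L_mult_M[OF P[OF l] r c])
    also have "\<dots> = (\<Sum>\<xi>\<in>?S. of_int (signature \<xi>) *
      (if ?match l \<xi> then A $$ (?\<alpha> ! l, i) * B $$ (i, hd \<xi>) else 0))"
    proof (intro sum.cong[OF refl] arg_cong[of _ _ "\<lambda>x. _ * x"])
      fix \<xi> assume "\<xi> \<in> ?S"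
      note \<xi> = \<xi>[OF this]
      have "col A i $ (?\<alpha> ! l) = A $$ (?\<alpha> ! l, i)" "row B i $ hd \<xi> = B $$ (i, hd \<xi>)"
        using A B that(1) lt[OF \<open>\<xi> \<in> ?S\<close> that(2)] by simp_all
      moreover have "col A i \<in> carrier_vec n" "row B i \<in> carrier_vec n"
        using A B by auto
      ultimately show "((basis_kron n ?\<alpha>)\<^sup>T * (?P i (Suc l) * basis_kron n \<xi>)) $$ (0, 0) =
          (if ?match l \<xi> then A $$ (?\<alpha> ! l, i) * B $$ (i, hd \<xi>) else 0)"
        using matrix_element_of_insertion_and_contraction[OF _ _ \<alpha>(1,4) \<xi> that(2)] by simp
    qed
    finally show ?thesis .
  qed
  have "(L_mat n k * mat_sum ?N ?d (\<lambda>i. mat_sum ?N ?d (?f i) {1..k}) {0..<m}) $$ (r, c) =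
      (\<Sum>i = 0..<m. (L_mat n k * mat_sum ?N ?d (?f i) {1..k}) $$ (r, c))"
    using F L r c by (intro index_mult_mat_sum) auto
  also have "\<dots> = (\<Sum>i = 0..<m. \<Sum>l = 1..k. (L_mat n k * ?f i l) $$ (r, c))"
    using f L r c by (intro sum.cong[OF refl] index_mult_mat_sum) auto
  also have "\<dots> = (\<Sum>i = 0..<m. \<Sum>l<k. (L_mat n k * ?f i (Suc l)) $$ (r, c))"
    by (simp only: One_nat_def sum.atLeast1_atMost_eq)
  also have "\<dots> = (\<Sum>i = 0..<m. \<Sum>l<k. (-1) ^ l * (\<Sum>\<xi>\<in>?S. of_int (signature \<xi>) *
      (if ?match l \<xi> then A $$ (?\<alpha> ! l, i) * B $$ (i, hd \<xi>) else 0)))"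
    using summand by (intro sum.cong[OF refl]) simp_all
  \<comment> \<open>The sum over \<open>i\<close> of the products \<open>w\<^sup>i (v\<^sup>i)\<^sup>T\<close> is \<open>A * B\<close>, so \<open>i\<close> has to become the innermost index.\<close>
  also have "\<dots> = (\<Sum>l<k. \<Sum>i = 0..<m. (-1) ^ l * (\<Sum>\<xi>\<in>?S. of_int (signature \<xi>) *
      (if ?match l \<xi> then A $$ (?\<alpha> ! l, i) * B $$ (i, hd \<xi>) else 0)))"
    by (rule sum.swap)
  also have "\<dots> = (\<Sum>l<k. (-1) ^ l * (\<Sum>\<xi>\<in>?S. of_int (signature \<xi>) *
      (if ?match l \<xi> then (A * B) $$ (?\<alpha> ! l, hd \<xi>) else 0)))"
  proof (rule sum.cong[OF refl])
    fix l assume "l \<in> {..<k}"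
    then have l: "l < k" by simp
    have prod: "(\<Sum>i = 0..<m. A $$ (?\<alpha> ! l, i) * B $$ (i, hd \<xi>)) = (A * B) $$ (?\<alpha> ! l, hd \<xi>)"
      if "\<xi> \<in> ?S" for \<xi>
      using A B lt[OF that l] by (simp add: scalar_prod_def)
    have "(\<Sum>i = 0..<m. (-1) ^ l * (\<Sum>\<xi>\<in>?S. of_int (signature \<xi>) *
        (if ?match l \<xi> then A $$ (?\<alpha> ! l, i) * B $$ (i, hd \<xi>) else 0))) =
      (-1) ^ l * (\<Sum>\<xi>\<in>?S. \<Sum>i = 0..<m. of_int (signature \<xi>) *
        (if ?match l \<xi> then A $$ (?\<alpha> ! l, i) * B $$ (i, hd \<xi>) else 0))"
      by (subst sum.swap) (simp only: sum_distrib_left)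
    also have "(\<Sum>\<xi>\<in>?S. \<Sum>i = 0..<m. of_int (signature \<xi>) *
        (if ?match l \<xi> then A $$ (?\<alpha> ! l, i) * B $$ (i, hd \<xi>) else 0)) =
      (\<Sum>\<xi>\<in>?S. of_int (signature \<xi>) *
        (if ?match l \<xi> then (A * B) $$ (?\<alpha> ! l, hd \<xi>) else 0))"
    proof (rule sum.cong[OF refl])
      fix \<xi> assume "\<xi> \<in> ?S"
      from prod[OF this]
      show "(\<Sum>i = 0..<m. of_int (signature \<xi>) *
          (if ?match l \<xi> then A $$ (?\<alpha> ! l, i) * B $$ (i, hd \<xi>) else 0)) =
        of_int (signature \<xi>) * (if ?match l \<xi> then (A * B) $$ (?\<alpha> ! l, hd \<xi>) else 0)"
        by (cases "?match l \<xi>") (simp_all flip: sum_distrib_left)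
    qed
    finally show "(\<Sum>i = 0..<m. (-1) ^ l * (\<Sum>\<xi>\<in>?S. of_int (signature \<xi>) *
        (if ?match l \<xi> then A $$ (?\<alpha> ! l, i) * B $$ (i, hd \<xi>) else 0))) =
      (-1) ^ l * (\<Sum>\<xi>\<in>?S. of_int (signature \<xi>) *
        (if ?match l \<xi> then (A * B) $$ (?\<alpha> ! l, hd \<xi>) else 0))" .
  qed
  also have "\<dots> = add_compound k (A * B) $$ (r, c)"
    by (rule index_add_compound[OF AB r c, symmetric])
  finally show "add_compound k (A * B) $$ (r, c) =
      (L_mat n k * mat_sum ?N ?d (\<lambda>i. mat_sum ?N ?d (?f i) {1..k}) {0..<m}) $$ (r, c)" ..
qed

end
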